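(* Let $a$ be a real number with $0<a\le 1/e$. Then any infinite sequence $\varepsilon$ of signs $+,-$ represents an element of $\overline{\mathbb{R}}$ (i.e. the sequence $(u_{n,\varepsilon})_n$ converges in $\overline{\mathbb{R}}$). Moreover, the set of representable elements of $\overline{\mathbb{R}}$ is a closed subset of $\overline{\mathbb{R}}$ with empty interior; $a$ is therefore not suitable.
   Context: $\overline{\mathbb{R}}=[-\infty,+\infty]$ is the extended real line with its usual order topology; convergence is in $\overline{\mathbb{R}}$ (infinite limits allowed). For a fixed real $a>0$ define $f_+,f_-:\overline{\mathbb{R}}\to\overline{\mathbb{R}}$ by $f_+(x)=e^{ax}$ and $f_-(x)=-e^{ax}$, with $e^{-\infty}=0$, $e^{+\infty}=+\infty$. For an infinite sequence $\varepsilon=(\varepsilon_1,\varepsilon_2,\ldots)$ of signs $+$ and $-$ and $n\ge 0$, put $f_{n,\varepsilon}=f_{\varepsilon_1}\circ f_{\varepsilon_2}\circ\cdots\circ f_{\varepsilon_n}$ ($f_{0,\varepsilon}$ is the identity) and $u_{n,\varepsilon}=f_{n,\varepsilon}(1)$. The sequence $\varepsilon$ represents $t\in\overline{\mathbb{R}}$ if $u_{n,\varepsilon}\to t$ in $\overline{\mathbb{R}}$ as $n\to\infty$; $t\in\overline{\mathbb{R}}$ is representable if some $\varepsilon$ represents it. The number $a$ is suitable if every infinite sequence $\varepsilon$ represents an element of $\overline{\mathbb{R}}$ and every element of $\overline{\mathbb{R}}$ is representable. *)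

theory Defs
  imports "HOL-Analysis.Analysis"
begin

function ereal_exp :: "ereal \<Rightarrow> ereal" where
  "ereal_exp (ereal r) = ereal (exp r)"
| "ereal_exp \<infinity> = \<infinity>"
| "ereal_exp (-\<infinity>) = 0"
  using ereal_cases by auto
termination by lexicographic_order

datatype pm = Plus | Minus

fun f_sign :: "real \<Rightarrow> pm \<Rightarrow> ereal \<Rightarrow> ereal" where
  "f_sign a Plus x = ereal_exp (ereal a * x)"
| "f_sign a Minus x = - ereal_exp (ereal a * x)"

(* Sign sequences are indexed from 0: the i-th sign, counting from 1, is \<epsilon> (i - 1).
   Each new map is composed on the inside (on the right). *)
primrec f_comp :: "real \<Rightarrow> nat \<Rightarrow> (nat \<Rightarrow> pm) \<Rightarrow> ereal \<Rightarrow> ereal" where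
  "f_comp a 0 \<epsilon> = id"
| "f_comp a (Suc n) \<epsilon> = f_comp a n \<epsilon> \<circ> f_sign a (\<epsilon> n)"

definition u_seq :: "real \<Rightarrow> (nat \<Rightarrow> pm) \<Rightarrow> nat \<Rightarrow> ereal" where
  "u_seq a \<epsilon> n = f_comp a n \<epsilon> 1"

definition represents :: "real \<Rightarrow> (nat \<Rightarrow> pm) \<Rightarrow> ereal \<Rightarrow> bool" where
  "represents a \<epsilon> t \<longleftrightarrow> u_seq a \<epsilon> \<longlonglongrightarrow> t"

definition representable :: "real \<Rightarrow> ereal \<Rightarrow> bool" where
  "representable a t \<longleftrightarrow> (\<exists>\<epsilon>. represents a \<epsilon> t)"

definition suitable :: "real \<Rightarrow> bool" where
  "suitable a \<longleftrightarrow> (\<forall>\<epsilon>. \<exists>t. represents a \<epsilon> t) \<and> (\<forall>t. representable a t)"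

end

(* For a <= 1/e both maps send J = [-e, e] into itself, and there they shrink a distance h to at most
   h / (1 + h/(2e)).  These bounds compose: any n-fold composition maps J onto a set of diameter
   at most 2e/n.  Hence every sign sequence converges, and the set K of limits is the largest subset
   of J with K = f_+(K) \<union> f_-(K).  The closure of K has the same property, so K is closed.  Since 0 is
   not in K, a connected subset of K lies on one side of 0, so it is the image under a single map
   of a connected subset of K; iterating, it lies in the image of J under compositions of any length
   and is therefore at most a point. *)
theory Submission
  imports Defs
begin

section \<open>Real-valued counterparts of the maps and their compositions\<close>

fun f_real :: "real \<Rightarrow> pm \<Rightarrow> real \<Rightarrow> real" where
  "f_real a Plus x = exp (a * x)"
| "f_real a Minus x = - exp (a * x)"

primrec real_comp :: "real \<Rightarrow> nat \<Rightarrow> (nat \<Rightarrow> pm) \<Rightarrow> real \<Rightarrow> real" where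
  "real_comp a 0 \<epsilon> = id"
| "real_comp a (Suc n) \<epsilon> = real_comp a n \<epsilon> \<circ> f_real a (\<epsilon> n)"

definition real_representable :: "real \<Rightarrow> real set" where
  "real_representable a = {t. \<exists>\<epsilon>. (\<lambda>n. real_comp a n \<epsilon> 1) \<longlonglongrightarrow> t}"

lemma f_sign_ereal: "f_sign a s (ereal x) = ereal (f_real a s x)"
  by (cases s) auto

lemma f_comp_ereal: "f_comp a n \<epsilon> (ereal x) = ereal (real_comp a n \<epsilon> x)"
  by (induction n arbitrary: x) (auto simp: f_sign_ereal)

lemma u_seq_ereal: "u_seq a \<epsilon> n = ereal (real_comp a n \<epsilon> 1)"
  unfolding u_seq_def by (metis f_comp_ereal one_ereal_def)

text \<open>The recursion peels off the innermost map. Peeling off the outermost one instead relates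
  a sign sequence to its shift.\<close>

lemma real_comp_Suc_left:
  "real_comp a (Suc n) \<epsilon> = f_real a (\<epsilon> 0) \<circ> real_comp a n (\<lambda>i. \<epsilon> (Suc i))"
proof (induction n)
  case 0
  then show ?case by simp
next
  case (Suc n)
  have "real_comp a (Suc (Suc n)) \<epsilon> = real_comp a (Suc n) \<epsilon> \<circ> f_real a (\<epsilon> (Suc n))"
    by (rule real_comp.simps)
  then show ?case
    unfolding Suc.IH by (simp add: comp_assoc)
qed

lemma continuous_on_f_real: "continuous_on S (f_real a s)"
proof (cases s)
  case Plus
  then have "f_real a s = (\<lambda>x. exp (a * x))" by auto
  then show ?thesis by (auto intro!: continuous_intros)
next
  case Minus
  then have "f_real a s = (\<lambda>x. - exp (a * x))" by auto
  then show ?thesis by (auto intro!: continuous_intros)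
qed

lemma f_real_nonzero: "f_real a s x \<noteq> 0"
  by (cases s) auto

lemma abs_f_real: "\<bar>f_real a s x\<bar> = exp (a * x)"
  by (cases s) auto

lemma abs_f_real_diff: "\<bar>f_real a s x - f_real a s y\<bar> = \<bar>exp (a * x) - exp (a * y)\<bar>"
  by (cases s) auto

text \<open>One formula inverts both maps, so a preimage can be written down before the sign
  \<open>s\<close> is known.\<close>

lemma f_real_ln_abs:
  assumes "a \<noteq> 0" and "if s = Plus then x > 0 else x < 0"
  shows "f_real a s (ln \<bar>x\<bar> / a) = x"
  using assms by (cases s) auto

section \<open>The scalar inequality and the contraction rate\<close>

lemma one_minus_exp_neg_le:
  fixes t :: real
  assumes "0 \<le> t"
  shows "1 - exp (- t) \<le> t / (1 + t / 2)"
proof -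
  \<comment> \<open>Multiplied by \<open>2 + t\<close>, the claim rearranges to
    \<open>0 \<le> q t\<close>. Since \<open>q 0 = 0\<close>, it suffices that \<open>q\<close> is
    nondecreasing.\<close>
  define q where "q t = (2 + t) * exp (- t) - 2 + t" for t :: real
  have "q 0 \<le> q t"
  proof (rule DERIV_nonneg_imp_nondecreasing[OF assms])
    fix x :: real
    assume "0 \<le> x"
    have "(q has_real_derivative 1 - (1 + x) * exp (- x)) (at x)"
      unfolding q_def by (auto intro!: derivative_eq_intros simp: algebra_simps)
    moreover have "(1 + x) * exp (- x) \<le> exp x * exp (- x)"
      by (intro mult_right_mono exp_ge_add_one_self) simp
    ultimately show "\<exists>y. (q has_real_derivative y) (at x) \<and> 0 \<le> y"
      by (auto simp: exp_minus)
  qed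
  then show ?thesis
    using assms by (simp add: q_def field_simps)
qed

text \<open>In the coordinate \<open>1 / h\<close> this is translation by
  \<open>n / (2 * exp 1)\<close>, so for natural \<open>n\<close> it is the n-fold iterate of
  \<open>shrink 1\<close>.\<close>

definition shrink :: "real \<Rightarrow> real \<Rightarrow> real" where
  "shrink n h = h / (1 + n * h / (2 * exp 1))"

lemma shrink_mono:
  assumes "0 \<le> n" "0 \<le> h" "h \<le> k"
  shows "shrink n h \<le> shrink n k"
proof -
  have pos: "0 < 1 + n * h / (2 * exp 1)" "0 < 1 + n * k / (2 * exp 1)"
    using assms by (auto intro!: add_pos_nonneg)
  show ?thesis
    \<comment> \<open>Over the common denominator the cross terms cancel and the numerator is
      \<open>h - k\<close>.\<close>
    unfolding shrink_def frac_le_eq[OF less_imp_neq[OF pos(1), symmetric] less_imp_neq[OF pos(2), symmetric]]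
    using pos assms(3) by (intro divide_nonpos_pos mult_pos_pos) (auto simp: algebra_simps)
qed

lemma shrink_shrink:
  assumes "0 \<le> n" "0 \<le> h"
  shows "shrink n (shrink 1 h) = shrink (n + 1) h"
proof -
  define E :: real where "E = 2 * exp 1"
  have E: "0 < E" "0 < E + h" "0 < E + (n + 1) * h"
    using assms by (auto simp: E_def intro!: add_pos_nonneg)
  have shrink_eq: "shrink m k = E * k / (E + m * k)" for m k
    using E(1) unfolding shrink_def E_def[symmetric] by (simp add: field_simps)
  have "E + n * (E * h / (E + h)) = E * (E + (n + 1) * h) / (E + h)"
    using E by (simp add: field_simps)
  then show ?thesis
    unfolding shrink_eq using E by simp
qed

lemma shrink_le:
  assumes "0 < n" "0 \<le> h"
  shows "shrink n h \<le> 2 * exp 1 / n"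
proof -
  have "0 < 2 * exp 1 + n * h"
    using assms by (auto intro!: add_pos_nonneg)
  then show ?thesis
    using assms unfolding shrink_def by (simp add: field_simps)
qed

section \<open>Contraction on \<open>J\<close> and convergence\<close>

locale small_rate =
  fixes a :: real
  assumes a_pos: "0 < a" and a_le: "a \<le> 1 / exp 1"
begin

abbreviation J :: "real set" where "J \<equiv> {- exp 1..exp 1}"
abbreviation K :: "real set" where "K \<equiv> real_representable a"

text \<open>The right endpoint of \<open>J\<close> is chosen so that
  \<open>a * exp 1 \<le> 1\<close>, which keeps the exponent at most 1.\<close>

lemma exp_le_on_J: "x \<in> J \<Longrightarrow> exp (a * x) \<le> exp 1"
proof -
  assume "x \<in> J"
  then have "a * x \<le> a * exp 1" using a_pos by simp
  also have "\<dots> \<le> 1" using a_le by (simp add: field_simps)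
  finally show ?thesis by simp
qed

lemma f_real_in_J: "x \<in> J \<Longrightarrow> f_real a s x \<in> J"
  using exp_le_on_J[of x] abs_f_real[of a s x] abs_le_iff[of "f_real a s x" "exp 1"] by auto

lemma real_comp_in_J: "x \<in> J \<Longrightarrow> real_comp a n \<epsilon> x \<in> J"
  by (induction n arbitrary: x) (auto simp del: atLeastAtMost_iff simp: f_real_in_J)

lemma exp_diff_le:
  assumes "y \<in> J" "x \<le> y"
  shows "exp (a * y) - exp (a * x) \<le> shrink 1 (y - x)"
proof -
  \<comment> \<open>Factoring out \<open>exp (a * y)\<close> leaves the exponent
    \<open>a * (y - x)\<close>, at most \<open>t\<close>. As \<open>exp 1 * t = y - x\<close>, the
    scalar inequality at \<open>t\<close> yields exactly \<open>shrink 1\<close>.\<close>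
  define t where "t = (y - x) / exp 1"
  have t: "0 \<le> t" "a * (y - x) \<le> t"
    using assms(2) mult_right_mono[OF a_le, of "y - x"] by (auto simp: t_def)
  have "exp (a * y) - exp (a * x) = exp (a * y) * (1 - exp (- (a * (y - x))))"
    by (simp add: algebra_simps flip: exp_add)
  also have "\<dots> \<le> exp 1 * (1 - exp (- t))"
    using exp_le_on_J[OF assms(1)] t a_pos assms(2) by (intro mult_mono) auto
  also have "\<dots> \<le> exp 1 * (t / (1 + t / 2))"
    by (intro mult_left_mono one_minus_exp_neg_le t(1)) simp
  also have "\<dots> = shrink 1 (y - x)"
    by (simp add: t_def shrink_def mult.commute)
  finally show ?thesis .
qed

lemma f_real_shrink:
  assumes "x \<in> J" "y \<in> J"
  shows "\<bar>f_real a s x - f_real a s y\<bar> \<le> shrink 1 \<bar>x - y\<bar>"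
proof (cases "x \<le> y")
  case True
  then have "exp (a * x) \<le> exp (a * y)" using a_pos by simp
  then show ?thesis
    using exp_diff_le[OF assms(2) True] True by (simp add: abs_f_real_diff abs_minus_commute)
next
  case False
  then have "y \<le> x" "exp (a * y) \<le> exp (a * x)" using a_pos by simp_all
  then show ?thesis
    using exp_diff_le[OF assms(1) \<open>y \<le> x\<close>] by (simp add: abs_f_real_diff)
qed

lemma real_comp_shrink:
  assumes "x \<in> J" "y \<in> J"
  shows "\<bar>real_comp a n \<epsilon> x - real_comp a n \<epsilon> y\<bar> \<le> shrink n \<bar>x - y\<bar>"
  using assms
proof (induction n arbitrary: x y)
  case 0
  then show ?case by (simp add: shrink_def)
next
  case (Suc n)
  let ?x = "f_real a (\<epsilon> n) x" and ?y = "f_real a (\<epsilon> n) y"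
  have "\<bar>real_comp a n \<epsilon> ?x - real_comp a n \<epsilon> ?y\<bar> \<le> shrink n \<bar>?x - ?y\<bar>"
    using Suc.prems by (intro Suc.IH f_real_in_J)
  also have "\<dots> \<le> shrink n (shrink 1 \<bar>x - y\<bar>)"
    using Suc.prems by (intro shrink_mono f_real_shrink) auto
  also have "\<dots> = shrink (Suc n) \<bar>x - y\<bar>"
    by (simp add: shrink_shrink add.commute)
  finally show ?case by simp
qed

lemma real_comp_dist_le:
  assumes "x \<in> J" "y \<in> J" "0 < n"
  shows "\<bar>real_comp a n \<epsilon> x - real_comp a n \<epsilon> y\<bar> \<le> 2 * exp 1 / n"
  using real_comp_shrink[OF assms(1,2), of n \<epsilon>] shrink_le[of n "\<bar>x - y\<bar>"] assms(3) by simp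

lemma one_in_J: "1 \<in> J"
  by (auto intro: order_trans[of _ 0])

lemma bound_tendsto_0: "(\<lambda>n. 2 * exp 1 / real n) \<longlonglongrightarrow> 0"
  by (rule lim_const_over_n)

text \<open>The \<open>k\<close> inner maps only move the starting point within \<open>J\<close>, so
  all later terms lie in the image of \<open>J\<close> under the first \<open>n\<close>
  maps.\<close>

lemma real_comp_add_ex:
  assumes "x \<in> J"
  shows "\<exists>z\<in>J. real_comp a (n + k) \<epsilon> x = real_comp a n \<epsilon> z"
  using assms
proof (induction k arbitrary: x)
  case 0
  then show ?case by auto
next
  case (Suc k)
  from Suc.IH[OF f_real_in_J[OF Suc.prems]] show ?case by simp
qed

lemma convergent_real_comp: "convergent (\<lambda>n. real_comp a n \<epsilon> 1)"
proof -
  have "Cauchy (\<lambda>n. real_comp a n \<epsilon> 1)"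
  proof (rule metric_CauchyI)
    fix e :: real
    assume "0 < e"
    then have "\<forall>\<^sub>F n in sequentially. 2 * exp 1 / real n < e / 2"
      by (intro order_tendstoD(2)[OF bound_tendsto_0]) simp
    then obtain N where N: "\<And>n. n \<ge> N \<Longrightarrow> 2 * exp 1 / real n < e / 2"
      by (auto simp: eventually_sequentially)
    \<comment> \<open>The successor makes the index positive, as \<open>real_comp_dist_le\<close>
      demands.\<close>
    define M where "M = Suc N"
    have close: "\<bar>real_comp a m \<epsilon> 1 - real_comp a M \<epsilon> 1\<bar> < e / 2" if "m \<ge> M" for m
    proof -
      obtain z where "z \<in> J" "real_comp a m \<epsilon> 1 = real_comp a M \<epsilon> z"
        using real_comp_add_ex[OF one_in_J, of M "m - M" \<epsilon>] \<open>m \<ge> M\<close> by auto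
      then show ?thesis
        using real_comp_dist_le[of z 1 M \<epsilon>] one_in_J N[of M] by (simp add: M_def)
    qed
    have "dist (real_comp a m \<epsilon> 1) (real_comp a n \<epsilon> 1) < e" if "m \<ge> M" "n \<ge> M" for m n
      using close[OF that(1)] close[OF that(2)] unfolding dist_real_def by linarith
    then show "\<exists>M. \<forall>m\<ge>M. \<forall>n\<ge>M. dist (real_comp a m \<epsilon> 1) (real_comp a n \<epsilon> 1) < e"
      by blast
  qed
  then show ?thesis by (rule Cauchy_convergent)
qed

section \<open>Self-similarity and compactness of \<open>K\<close>\<close>

lemma K_subset_J: "K \<subseteq> J"
proof
  fix t
  assume "t \<in> K"
  then obtain \<epsilon> where "(\<lambda>n. real_comp a n \<epsilon> 1) \<longlonglongrightarrow> t"
    by (auto simp: real_representable_def)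
  then show "t \<in> J"
    by (rule closed_sequentially[OF closed_atLeastAtMost, rotated])
       (rule real_comp_in_J[OF one_in_J])
qed

text \<open>By continuity, a limit is the image, under the outermost map, of the limit for the
  shifted sign sequence.\<close>

lemma K_subset_images: "K \<subseteq> (\<Union>s\<in>{Plus, Minus}. f_real a s ` K)"
proof
  fix t
  assume "t \<in> K"
  then obtain \<epsilon> where \<epsilon>: "(\<lambda>n. real_comp a n \<epsilon> 1) \<longlonglongrightarrow> t"
    by (auto simp: real_representable_def)
  let ?\<epsilon>' = "\<lambda>i. \<epsilon> (Suc i)"
  obtain k where k: "(\<lambda>n. real_comp a n ?\<epsilon>' 1) \<longlonglongrightarrow> k"
    using convergent_real_comp by (auto simp: convergent_def)
  have "(\<lambda>n. f_real a (\<epsilon> 0) (real_comp a n ?\<epsilon>' 1)) \<longlonglongrightarrow> f_real a (\<epsilon> 0) k"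
    using continuous_on_tendsto_compose[OF continuous_on_f_real[of UNIV] k] by simp
  then have "(\<lambda>n. real_comp a (Suc n) \<epsilon> 1) \<longlonglongrightarrow> f_real a (\<epsilon> 0) k"
    by (simp only: real_comp_Suc_left o_apply)
  then have "t = f_real a (\<epsilon> 0) k"
    using LIMSEQ_unique LIMSEQ_Suc[OF \<epsilon>] by blast
  moreover have "k \<in> K"
    using k by (auto simp: real_representable_def)
  ultimately show "t \<in> (\<Union>s\<in>{Plus, Minus}. f_real a s ` K)"
    by (cases "\<epsilon> 0") auto
qed

text \<open>Choosing preimages inside \<open>S\<close> forever gives a backward orbit of
  \<open>t\<close>. Its signs represent \<open>t\<close>, since \<open>t\<close> and the n-th term
  are images of two points of \<open>J\<close> under the same n-fold composition.\<close>

lemma subset_K_coinduct: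
  assumes "S \<subseteq> J" and "S \<subseteq> (\<Union>s\<in>{Plus, Minus}. f_real a s ` S)"
  shows "S \<subseteq> K"
proof
  fix t
  assume "t \<in> S"
  have "\<forall>x\<in>S. \<exists>s. \<exists>y\<in>S. x = f_real a s y"
    using assms(2) by blast
  then obtain \<sigma> next' where step: "\<And>x. x \<in> S \<Longrightarrow> next' x \<in> S \<and> x = f_real a (\<sigma> x) (next' x)"
    by metis
  define \<epsilon> where "\<epsilon> n = \<sigma> ((next' ^^ n) t)" for n
  have orbit: "(next' ^^ n) t \<in> S" for n
    using \<open>t \<in> S\<close> step by (induction n) auto
  have t_eq: "t = real_comp a n \<epsilon> ((next' ^^ n) t)" for n
  proof (induction n)
    case 0
    then show ?case by simp
  next
    case (Suc n)
    then show ?case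
      using step[OF orbit[of n]] by (simp add: \<epsilon>_def)
  qed
  have "\<bar>real_comp a n \<epsilon> 1 - t\<bar> \<le> 2 * exp 1 / n" if "0 < n" for n
    using real_comp_dist_le[OF one_in_J subsetD[OF assms(1) orbit[of n]] that, of \<epsilon>] t_eq[of n]
    by simp
  then have "(\<lambda>n. real_comp a n \<epsilon> 1 - t) \<longlonglongrightarrow> 0"
    by (intro Lim_null_comparison[OF _ bound_tendsto_0])
       (auto intro: eventually_sequentiallyI[of 1])
  then show "t \<in> K"
    by (auto simp: real_representable_def LIM_zero_iff)
qed

lemma compact_K: "compact K"
proof -
  have J: "closure K \<subseteq> J"
    by (intro closure_minimal K_subset_J closed_atLeastAtMost)
  then have cpt: "compact (closure K)"
    using bounded_subset[OF bounded_closed_interval] by (auto simp: compact_eq_bounded_closed)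
  have "closure K \<subseteq> (\<Union>s\<in>{Plus, Minus}. f_real a s ` closure K)"
  proof (rule closure_minimal)
    show "K \<subseteq> (\<Union>s\<in>{Plus, Minus}. f_real a s ` closure K)"
      by (rule order_trans[OF K_subset_images UN_mono[OF subset_refl image_mono[OF closure_subset]]])
    \<comment> \<open>Continuous images of closed sets need not be closed; compactness of
      \<open>closure K\<close> supplies this.\<close>
    show "closed (\<Union>s\<in>{Plus, Minus}. f_real a s ` closure K)"
      by (intro compact_imp_closed compact_UN compact_continuous_image continuous_on_f_real cpt) auto
  qed
  then have "closure K \<subseteq> K"
    by (rule subset_K_coinduct[OF J])
  with cpt closure_subset[of K] show ?thesis
    by (metis subset_antisym)
qed

section \<open>Connected subsets of \<open>K\<close>\<close>

lemma zero_notin_K: "0 \<notin> K"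
proof
  assume "0 \<in> K"
  then obtain s k where "0 = f_real a s k"
    using K_subset_images by blast
  then show False
    by (metis f_real_nonzero)
qed

lemma ln_abs_in_K:
  assumes "x \<in> K"
  shows "ln \<bar>x\<bar> / a \<in> K"
proof -
  obtain s k where "k \<in> K" "x = f_real a s k"
    using assms K_subset_images by blast
  then show ?thesis
    using a_pos by (simp add: abs_f_real)
qed

text \<open>As \<open>S\<close> avoids 0, its points share one sign, which determines
  \<open>s\<close>. Off 0 the inverse formula is continuous, so \<open>T\<close>, the image of
  \<open>S\<close> under it, is connected.\<close>

lemma connected_pull_back:
  assumes "connected S" "S \<subseteq> K"
  shows "\<exists>s T. connected T \<and> T \<subseteq> K \<and> S = f_real a s ` T"
proof -
  let ?T = "(\<lambda>x. ln \<bar>x\<bar> / a) ` S"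
  have nz: "0 \<notin> S"
    using zero_notin_K assms(2) by blast
  have "\<exists>s. \<forall>x\<in>S. if s = Plus then x > 0 else x < 0"
  proof (cases "\<exists>x\<in>S. x > 0")
    case True
    then have "x > 0" if "x \<in> S" for x
      using connectedD_interval[OF assms(1) that] nz that by (metis linorder_le_less_linear less_imp_le)
    then show ?thesis by auto
  next
    case False
    then have "\<forall>x\<in>S. x < 0"
      using nz by (metis linorder_neqE)
    then show ?thesis by (metis pm.distinct(1))
  qed
  then obtain s where "\<forall>x\<in>S. f_real a s (ln \<bar>x\<bar> / a) = x"
    using f_real_ln_abs[of a] a_pos by (metis less_irrefl)
  then have "S = f_real a s ` ?T"
    by force
  moreover have "connected ?T"
    using nz a_pos
    by (intro connected_continuous_image assms(1) continuous_intros) auto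
  moreover have "?T \<subseteq> K"
    using ln_abs_in_K assms(2) by blast
  ultimately show ?thesis by blast
qed

lemma connected_pull_back_n:
  assumes "connected S" "S \<subseteq> K"
  shows "\<exists>\<epsilon> T. T \<subseteq> K \<and> S = real_comp a n \<epsilon> ` T"
  using assms
proof (induction n arbitrary: S)
  case 0
  then show ?case by auto
next
  case (Suc n)
  obtain s T where T: "connected T" "T \<subseteq> K" "S = f_real a s ` T"
    using connected_pull_back[OF Suc.prems] by blast
  obtain \<epsilon> U where U: "U \<subseteq> K" "T = real_comp a n \<epsilon> ` U"
    using Suc.IH[OF T(1,2)] by blast
  \<comment> \<open>\<open>case_nat s \<epsilon>\<close> prepends \<open>s\<close>, the sign of the
    outermost map.\<close>
  have "S = real_comp a (Suc n) (case_nat s \<epsilon>) ` U"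
    unfolding real_comp_Suc_left T(3) U(2) by (simp add: image_comp)
  with U(1) show ?case by blast
qed

lemma connected_subset_K_trivial:
  assumes "connected S" "S \<subseteq> K" "x \<in> S" "y \<in> S"
  shows "x = y"
proof -
  have "\<bar>x - y\<bar> \<le> 2 * exp 1 / real n" if n: "n \<ge> 1" for n
  proof -
    obtain \<epsilon> T where T: "T \<subseteq> K" "S = real_comp a n \<epsilon> ` T"
      using connected_pull_back_n[OF assms(1,2)] by blast
    then obtain x' y' where "x' \<in> T" "y' \<in> T" "x = real_comp a n \<epsilon> x'" "y = real_comp a n \<epsilon> y'"
      using assms(3,4) by blast
    then show ?thesis
      using real_comp_dist_le[of x' y' n \<epsilon>] T(1) K_subset_J n by (simp add: subset_eq)
  qed
  then have "\<bar>x - y\<bar> \<le> 0"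
    by (intro Lim_bounded2[OF bound_tendsto_0, of 1]) auto
  then show ?thesis by simp
qed

lemma interior_K: "interior K = {}"
proof (rule ccontr)
  assume "interior K \<noteq> {}"
  then obtain x e where e: "0 < e" "cball x e \<subseteq> K"
    by (auto simp: mem_interior_cball)
  \<comment> \<open>A ball in the reals is connected, yet contains both \<open>x\<close> and
    \<open>x + e\<close>.\<close>
  then have "x = x + e"
    by (intro connected_subset_K_trivial[of "cball x e"]) (auto simp: dist_real_def)
  with e(1) show False by simp
qed

section \<open>Return to the extended reals\<close>

lemma ex_represents: "\<exists>t. represents a \<epsilon> t"
proof -
  obtain t where "(\<lambda>n. real_comp a n \<epsilon> 1) \<longlonglongrightarrow> t"
    using convergent_real_comp by (auto simp: convergent_def)
  then have "represents a \<epsilon> (ereal t)"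
    by (simp add: represents_def u_seq_ereal [abs_def])
  then show ?thesis ..
qed

lemma representable_eq: "{t. representable a t} = ereal ` K"
proof (intro equalityI subsetI)
  fix t
  assume "t \<in> {t. representable a t}"
  then obtain \<epsilon> where \<epsilon>: "u_seq a \<epsilon> \<longlonglongrightarrow> t"
    by (auto simp: representable_def represents_def)
  obtain r where r: "(\<lambda>n. real_comp a n \<epsilon> 1) \<longlonglongrightarrow> r"
    using convergent_real_comp by (auto simp: convergent_def)
  then have "u_seq a \<epsilon> \<longlonglongrightarrow> ereal r"
    by (simp add: u_seq_ereal [abs_def])
  with \<epsilon> have "t = ereal r"
    by (rule LIMSEQ_unique)
  with r show "t \<in> ereal ` K"
    by (auto simp: real_representable_def)
next
  fix t
  assume "t \<in> ereal ` K"
  then show "t \<in> {t. representable a t}"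
    by (auto simp: real_representable_def representable_def represents_def u_seq_ereal [abs_def])
qed

text \<open>Compactness of \<open>K\<close> matters here: an unbounded closed set of reals is not
  closed among the extended reals.\<close>

lemma closed_representable: "closed {t. representable a t}"
  unfolding representable_eq
  by (intro compact_imp_closed compact_continuous_image compact_K continuous_on_ereal continuous_on_id)

lemma interior_representable: "interior {t. representable a t} = {}"
proof -
  let ?U = "interior (ereal ` K)"
  have "open (ereal -` ?U)"
    by (intro open_ereal_vimage open_interior)
  moreover have "ereal -` ?U \<subseteq> K"
    using interior_subset[of "ereal ` K"] by auto
  ultimately have "ereal -` ?U \<subseteq> interior K"
    by (rule interior_maximal[rotated])
  then have "ereal -` ?U = {}"
    by (simp add: interior_K)
  \<comment> \<open>The interior consists of finite points only, so its empty preimage under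
    \<open>ereal\<close> makes it empty.\<close>
  then show ?thesis
    unfolding representable_eq using interior_subset[of "ereal ` K"] by blast
qed

end

theorem proposition2:
  fixes a :: real
  assumes "0 < a" and "a \<le> 1 / exp 1"
  shows "(\<forall>\<epsilon>. \<exists>t. represents a \<epsilon> t)
    \<and> closed {t. representable a t}
    \<and> interior {t. representable a t} = {}
    \<and> \<not> suitable a"
proof -
  interpret small_rate a
    using assms by unfold_locales
  \<comment> \<open>Suitability would make the representable set the whole space, whose interior is
    not empty.\<close>
  have "\<not> suitable a"
    using interior_representable by (auto simp: suitable_def)
  then show ?thesis
    using ex_represents closed_representable interior_representable by blast
qed

end
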